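(* For every given $\boldsymbol\mu\in\mathcal P$ and every given observation $y_d\in Y_{\mathrm{obs}}^{N_h}$, there exists a unique pair $(y,p)\in Y^{N_h}\times Y^{N_h}$ such that $$\mathcal B_s((y,p),(z,q);\boldsymbol\mu)=\langle\mathcal F_s(\boldsymbol\mu),(z,q)\rangle\qquad\text{for all }(z,q)\in Y^{N_h}\times Y^{N_h}.$$
   Context: Let $\mathcal P\subset\mathbb R^{d}$ be a parameter set, $\Omega\subset\mathbb R^n$ ($n=1,2,3$) an open bounded regular domain, $\Omega_{\mathrm{obs}}\subseteq\Omega$ the observation domain, $\Omega_u\subset\overline\Omega$ the control domain, and $0<\alpha\le1$ fixed. $Y$ is a separable Hilbert space over $\Omega$, $U$ a Hilbert space over $\Omega_u$, $Y_{\mathrm{obs}}$ a Hilbert space of observations; $Y$ and $U$ are contained in $L^2$. Moreover $Y\subseteq Y_{\mathrm{obs}}$ and $Y\subseteq U$, with constants $c_{\mathrm{obs}},c_u>0$ (possibly depending on $\boldsymbol\mu$) such that $\|y\|_{Y_{\mathrm{obs}}}\le c_{\mathrm{obs}}\|y\|_Y$ and $\|y\|_U\le c_u\|y\|_Y$ for all $y\in Y$. For each $\boldsymbol\mu\in\mathcal P$: - $a(\cdot,\cdot;\boldsymbol\mu):Y\times Y\to\mathbb R$ is bilinear, continuous with constant $c_a(\boldsymbol\mu)$ and coercive with constant $\gamma_a(\boldsymbol\mu)>0$. - $c(\cdot,\cdot;\boldsymbol\mu):U\times Y\to\mathbb R$ is bilinear, continuous with constant $c_c(\boldsymbol\mu)$,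 and is the $L^2$ scalar product over $\Omega_u$ weighted by $\sum_{i=1}^{Q_C}c_C^i(\boldsymbol\mu)\chi_{\Omega_C^i}$ with $c_C^i(\boldsymbol\mu)>0$ and $\bigcup_i\Omega_C^i=\Omega_u$; since $Y\subseteq U$, $c(p,z;\boldsymbol\mu)$ is defined for $p,z\in Y$. - $m(\cdot,\cdot;\boldsymbol\mu):Y\times Y\to\mathbb R$ is bilinear, symmetric, positive semidefinite, continuous with constant $c_m(\boldsymbol\mu)$, and is the (possibly positively weighted, because of pull-back to $\Omega$) $L^2$ scalar product over $\Omega_{\mathrm{obs}}$; it is also defined and continuous with first argument in $Y_{\mathrm{obs}}$. If $\Omega_u=\Omega_{\mathrm{obs}}$, then $c$ and $m$ coincide. The steady optimality bilinear form is $$\mathcal B_s((y,p),(z,q);\boldsymbol\mu)=a(y,z;\boldsymbol\mu)-\tfrac1\alpha c(p,z;\boldsymbol\mu)+m(y,q;\boldsymbol\mu)+a(q,p;\boldsymbol\mu),$$ and $\langle\mathcal F_s(\boldsymbol\mu),(z,q)\rangle=m(y_d,q;\boldsymbol\mu)+\langle G(\boldsymbol\mu),z\rangle_{Y^*,Y}$ with given $G(\boldsymbol\mu)\in Y^*$. The finite element space is $Y^{N_h}=Y\cap\mathcal X_1$, of dimension $N_h$, where $\mathcal X_1$ is the space of continuous piecewise affine functions on a triangulation of $\Omega$; $Y_{\mathrm{obs}}^{N_h}$ is a finite-dimensional (finite element) subspace of $Y_{\mathrm{obs}}$. *)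

theory Defs
  imports "HOL-Analysis.Analysis"
begin

text \<open>Locally, in a rotated coordinate system with vertical axis \<open>e\<close>, the domain is the strict
  epigraph of a Lipschitz function of the coordinates orthogonal to \<open>e\<close>.\<close>

definition lipschitz_domain :: "'a::euclidean_space set \<Rightarrow> bool" where
  "lipschitz_domain \<Omega> \<longleftrightarrow>
     open \<Omega> \<and> connected \<Omega> \<and> \<Omega> \<noteq> {} \<and>
     (\<forall>x0\<in>frontier \<Omega>. \<exists>r>0. \<exists>e g L. norm e = 1 \<and> lipschitz_on L {x. x \<bullet> e = 0} g \<and>
        (\<forall>x\<in>ball x0 r. x \<in> \<Omega> \<longleftrightarrow> g (x - (x \<bullet> e) *\<^sub>R e) < x \<bullet> e))"

definition triangulation_of :: "'a::euclidean_space set \<Rightarrow> 'a set set \<Rightarrow> bool" where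
  "triangulation_of \<Omega> \<T> \<longleftrightarrow>
     triangulation \<T> \<and> (\<forall>T\<in>\<T>. int DIM('a) simplex T) \<and> \<Union>\<T> = closure \<Omega>"

text \<open>Only the values on \<open>closure \<Omega>\<close> matter; functions are total and unconstrained outside.\<close>

definition cont_piecewise_affine ::
  "'a::euclidean_space set \<Rightarrow> 'a set set \<Rightarrow> ('a \<Rightarrow> real) set" where
  "cont_piecewise_affine \<Omega> \<T> =
     {v. continuous_on (closure \<Omega>) v \<and> (\<forall>T\<in>\<T>. \<exists>b k. \<forall>x\<in>T. v x = b \<bullet> x + k)}"

text \<open>The \<open>k\<close>-dimensional Hausdorff measure, normalised so that it agrees with the surface
  measure on \<open>k\<close>-dimensional Lipschitz surfaces. The empty set is treated separately because
  \<open>0 ^ 0 = 1\<close>. Hausdorff measure is countably additive on Borel sets, so \<open>measure_of\<close> does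
  not fall back to the zero measure.\<close>

definition hausdorff_premeasure :: "nat \<Rightarrow> real \<Rightarrow> 'a::euclidean_space set \<Rightarrow> ennreal" where
  "hausdorff_premeasure k \<delta> A =
     (INF C \<in> {C :: nat \<Rightarrow> 'a set. A \<subseteq> (\<Union>i. C i) \<and> (\<forall>i. bounded (C i) \<and> diameter (C i) \<le> \<delta>)}.
        \<Sum>i. if C i = {} then 0 else ennreal (unit_ball_vol (real k) * (diameter (C i) / 2) ^ k))"

definition hausdorff_measure :: "nat \<Rightarrow> 'a::euclidean_space measure" where
  "hausdorff_measure k =
     measure_of UNIV (sets borel) (\<lambda>A. SUP \<delta>\<in>{0<..}. hausdorff_premeasure k \<delta> A)"

text \<open>A space of (classes modulo a.e. equality of) functions on the measure space \<open>M\<close> is an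
  abstract vector space together with a map \<open>f\<close> choosing a representative of each element. Linearity
  and injectivity of the inclusion hold modulo \<open>M\<close>-null sets.\<close>

definition function_space :: "'a measure \<Rightarrow> ('v::real_vector \<Rightarrow> 'a \<Rightarrow> real) \<Rightarrow> bool" where
  "function_space M f \<longleftrightarrow>
     (\<forall>v. f v \<in> borel_measurable M) \<and>
     (\<forall>v w. AE x in M. f (v + w) x = f v x + f w x) \<and>
     (\<forall>r v. AE x in M. f (r *\<^sub>R v) x = r * f v x) \<and>
     (\<forall>v. (AE x in M. f v x = 0) \<longrightarrow> v = 0)"

definition L2_function_space :: "'a measure \<Rightarrow> ('v::real_vector \<Rightarrow> 'a \<Rightarrow> real) \<Rightarrow> bool" where
  "L2_function_space M f \<longleftrightarrow>
     function_space M f \<and> (\<forall>v. integrable M (\<lambda>x. (f v x)\<^sup>2))"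

text \<open>The inclusion \<open>j\<close> of a space of functions on \<open>\<Omega>\<close> (representatives \<open>f\<close>) into a space of
  functions on \<open>S \<subseteq> closure \<Omega>\<close> (representatives \<open>g\<close>, defined modulo \<open>\<sigma>\<close>-null sets) is the
  restriction to \<open>S\<close>. If \<open>S\<close> is a Lebesgue null set, e.g. a part of the boundary, the last clause
  says that \<open>j\<close> is the trace.\<close>

definition restriction_map ::
  "'a::euclidean_space set \<Rightarrow> 'a set \<Rightarrow> 'a measure \<Rightarrow>
   ('v::real_vector \<Rightarrow> 'a \<Rightarrow> real) \<Rightarrow> ('w::real_vector \<Rightarrow> 'a \<Rightarrow> real) \<Rightarrow> ('v \<Rightarrow> 'w) \<Rightarrow> bool" where
  "restriction_map \<Omega> S \<sigma> f g j \<longleftrightarrow>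
     linear j \<and>
     (\<forall>y. AE x in lebesgue_on (\<Omega> \<inter> S). g (j y) x = f y x) \<and>
     (\<forall>y v. continuous_on (closure \<Omega>) v \<and> (AE x in lebesgue_on \<Omega>. f y x = v x) \<longrightarrow>
        (AE x in \<sigma>. g (j y) x = v x))"

definition fe_space ::
  "'a::euclidean_space set \<Rightarrow> 'a set set \<Rightarrow> ('v::real_vector \<Rightarrow> 'a \<Rightarrow> real) \<Rightarrow> 'v set" where
  "fe_space \<Omega> \<T> f =
     {y. \<exists>v\<in>cont_piecewise_affine \<Omega> \<T>. AE x in lebesgue_on \<Omega>. f y x = v x}"

definition continuous_bilinear ::
  "('v::real_normed_vector \<Rightarrow> 'w::real_normed_vector \<Rightarrow> real) \<Rightarrow> real \<Rightarrow> bool" where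
  "continuous_bilinear b C \<longleftrightarrow>
     bilinear b \<and> (\<forall>v w. \<bar>b v w\<bar> \<le> C * norm v * norm w)"

definition coercive :: "('v::real_normed_vector \<Rightarrow> 'v \<Rightarrow> real) \<Rightarrow> real \<Rightarrow> bool" where
  "coercive b \<gamma> \<longleftrightarrow> \<gamma> > 0 \<and> (\<forall>v. b v v \<ge> \<gamma> * (norm v)\<^sup>2)"

text \<open>\<open>j\<close> is the inclusion of the state space into the control space, on which the first argument
  of \<open>c\<close> lives.\<close>

definition B_s ::
  "('y \<Rightarrow> 'y \<Rightarrow> real) \<Rightarrow> ('u \<Rightarrow> 'y \<Rightarrow> real) \<Rightarrow> ('y \<Rightarrow> 'y \<Rightarrow> real) \<Rightarrow> ('y \<Rightarrow> 'u) \<Rightarrow> real \<Rightarrow>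
   'y \<times> 'y \<Rightarrow> 'y \<times> 'y \<Rightarrow> real" where
  "B_s a c m j \<alpha> = (\<lambda>(y, p) (z, q). a y z - (1 / \<alpha>) * c (j p) z + m y q + a q p)"

definition F_s ::
  "('o \<Rightarrow> 'y \<Rightarrow> real) \<Rightarrow> ('y::real_normed_vector \<Rightarrow>\<^sub>L real) \<Rightarrow> 'o \<Rightarrow> 'y \<times> 'y \<Rightarrow> real" where
  "F_s m G yd = (\<lambda>(z, q). m yd q + blinfun_apply G z)"

end

(* The discrete system is square, so existence follows from uniqueness. If (y, p) solves the
   homogeneous system, testing with (p, y) gives c(p, p) / alpha = a(y, p) = - m(y, y). Both c(p, p)
   and m(y, y) are nonnegative, so m(y, y) = 0, and by Cauchy-Schwarz m(y, q) = 0 for all q. Then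
   a(q, p) = 0 for all q, so p = 0 by coercivity, and finally y = 0. The finite element space is
   finite-dimensional because a piecewise affine function is determined by its values at the
   finitely many vertices of the mesh. *)
theory Submission
  imports Defs
begin

section \<open>Linear systems in finite dimension\<close>

text \<open>Gaussian elimination, by induction on the set \<open>W\<close> of equations, with
  unknowns indexed by \<open>B\<close>. It serves twice: to solve the discrete problem, and to bound
  the dimension of the finite element space by the number of mesh vertices.\<close>

lemma homogeneous_system_nontrivial:
  fixes v :: "'b \<Rightarrow> 'w \<Rightarrow> real"
  assumes "finite W" "finite B" "card W < card B"
  shows "\<exists>c. (\<exists>b\<in>B. c b \<noteq> 0) \<and> (\<forall>w\<in>W. (\<Sum>b\<in>B. c b * v b w) = 0)"
  using assms
proof (induction W arbitrary: B v rule: finite_induct)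
  case empty
  then have "B \<noteq> {}" by auto
  then show ?case by (intro exI[of _ "\<lambda>_. 1"]) auto
next
  case (insert w W)
  show ?case
  proof (cases "\<forall>b\<in>B. v b w = 0")
    case True
    obtain c where "\<exists>b\<in>B. c b \<noteq> 0" "\<forall>w\<in>W. (\<Sum>b\<in>B. c b * v b w) = 0"
      using insert.IH[of B v] insert.prems insert.hyps by auto
    with True show ?thesis by (intro exI[of _ c]) auto
  next
    case False
    then obtain b0 where b0: "b0 \<in> B" "v b0 w \<noteq> 0" by blast
    define B' where "B' = B - {b0}"
    have B: "B = insert b0 B'" "b0 \<notin> B'" "finite B'"
      using b0 insert.prems by (auto simp: B'_def)
    \<comment> \<open>Equation \<open>w\<close> is solved for the unknown \<open>b0\<close>, and the
      result is substituted into every other equation \<open>u\<close>; \<open>v'\<close> holds the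
      coefficients of the reduced system.\<close>
    define v' where "v' b u = v b u - v b w / v b0 w * v b0 u" for b u
    have "card W < card B'"
      using insert.prems insert.hyps B by simp
    then obtain c where c: "\<exists>b\<in>B'. c b \<noteq> 0" "\<forall>u\<in>W. (\<Sum>b\<in>B'. c b * v' b u) = 0"
      using insert.IH[of B' v'] B by blast
    \<comment> \<open>The value of the unknown \<open>b0\<close> that equation \<open>w\<close>
      forces.\<close>
    define s where "s = - (\<Sum>b\<in>B'. c b * v b w / v b0 w)"
    have eq: "(\<Sum>b\<in>B. (c(b0 := s)) b * v b u) = (\<Sum>b\<in>B'. c b * v' b u)" for u
    proof -
      have "(\<Sum>b\<in>B'. (c(b0 := s)) b * v b u) = (\<Sum>b\<in>B'. c b * v b u)"
        using B(2) by (intro sum.cong) auto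
      moreover have "(\<Sum>b\<in>B'. c b * v' b u) = (\<Sum>b\<in>B'. c b * v b u) + s * v b0 u"
        by (simp add: v'_def s_def right_diff_distrib sum_subtractf sum_distrib_right mult.assoc)
      ultimately show ?thesis using B by simp
    qed
    \<comment> \<open>The reduced form of equation \<open>w\<close> is 0 = 0, so only the equations
      in \<open>W\<close> constrain \<open>c\<close>, and these are satisfied by the induction
      hypothesis.\<close>
    have "v' b w = 0" for b using b0 by (simp add: v'_def)
    then have "\<forall>u\<in>insert w W. (\<Sum>b\<in>B. (c(b0 := s)) b * v b u) = 0"
      unfolding eq using c(2) by simp
    moreover have "\<exists>b\<in>B. (c(b0 := s)) b \<noteq> 0"
      using c(1) B(1,2) by force
    ultimately show ?thesis by blast
  qed
qed

text \<open>The right-hand side is adjoined as one more unknown, which makes the homogeneous system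
  underdetermined. In a nontrivial solution the coefficient of the right-hand side cannot vanish,
  and dividing by it solves the problem.\<close>

lemma nondegenerate_bilinear_unique_solution:
  fixes b :: "'a::real_vector \<Rightarrow> 'a \<Rightarrow> real"
  assumes b: "bilinear b" and F: "linear F"
    and D: "finite D" "span D = S"
    and nondeg: "\<And>x. x \<in> S \<Longrightarrow> (\<And>z. z \<in> S \<Longrightarrow> b x z = 0) \<Longrightarrow> x = 0"
  shows "\<exists>!x. x \<in> S \<and> (\<forall>z\<in>S. b x z = F z)"
proof -
  obtain B where B: "B \<subseteq> D" "independent B" "D \<subseteq> span B"
    using maximal_independent_subset by blast
  have fin: "finite B" using B(1) D(1) by (rule finite_subset)
  have span_B: "span B = S"
    using B D span_mono span_minimal subspace_span by (metis subset_antisym)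
  have lin1: "linear (\<lambda>x. b x z)" and lin2: "linear (b x)" for x z
    using b by (auto simp: bilinear_def)
  \<comment> \<open>\<open>None\<close> indexes the right-hand side, with its sign changed, and
    \<open>Some x\<close> the basis vector \<open>x\<close>. There are \<open>card B + 1\<close>
    unknowns against \<open>card B\<close> equations, one for each basis vector used as test
    vector.\<close>
  define v where "v i e = (case i of None \<Rightarrow> - F e | Some x \<Rightarrow> b x e)" for i e
  have "\<exists>k. (\<exists>i\<in>insert None (Some ` B). k i \<noteq> 0) \<and>
         (\<forall>e\<in>B. (\<Sum>i\<in>insert None (Some ` B). k i * v i e) = 0)"
    using fin by (intro homogeneous_system_nontrivial) (auto simp: card_image)
  then obtain k where k: "\<exists>i\<in>insert None (Some ` B). k i \<noteq> 0"
     and k0: "\<And>e. e \<in> B \<Longrightarrow> (\<Sum>i\<in>insert None (Some ` B). k i * v i e) = 0"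
    by blast
  define t where "t = k None"
  define x where "x = (\<Sum>e\<in>B. k (Some e) *\<^sub>R e)"
  have xS: "x \<in> S"
    unfolding x_def span_B[symmetric] by (intro span_sum span_scale span_base)
  have "b x e = t * F e" if "e \<in> B" for e
  proof -
    have "b x e = (\<Sum>i\<in>B. k (Some i) * b i e)"
      by (simp add: x_def linear_sum[OF lin1] linear_scale[OF lin1])
    with k0[OF that] fin show ?thesis
      by (simp add: v_def t_def sum.reindex)
  qed
  then have eq: "b x z = t * F z" if "z \<in> S" for z
    using linear_eq_on_span[of "b x" "\<lambda>z. t * F z" B z] lin2 that F span_B
    by (auto intro!: linear_compose_scale_right[where 'b=real, unfolded real_scaleR_def])
  \<comment> \<open>If \<open>t\<close> were 0, then \<open>x\<close> would annihilate all of
    \<open>S\<close> and hence be 0; independence of \<open>B\<close> would then make every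
    coefficient vanish, against the nontriviality of \<open>k\<close>.\<close>
  have t: "t \<noteq> 0"
  proof
    assume "t = 0"
    then have "x = 0" using eq nondeg xS by simp
    then have "\<forall>e\<in>B. k (Some e) = 0"
      using B(2) fin unfolding x_def by (auto dest: independentD[OF B(2) fin subset_refl])
    with k \<open>t = 0\<close> show False by (auto simp: t_def)
  qed
  have subS: "subspace S" using D(2) by auto
  show ?thesis
  proof (rule ex1I[of _ "x /\<^sub>R t"])
    show "x /\<^sub>R t \<in> S \<and> (\<forall>z\<in>S. b (x /\<^sub>R t) z = F z)"
      using xS subS eq t by (simp add: subspace_scale linear_scale[OF lin1])
  next
    fix x' assume x': "x' \<in> S \<and> (\<forall>z\<in>S. b x' z = F z)"
    have "x' - x /\<^sub>R t = 0"
      using xS x' subS eq t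
      by (intro nondeg) (auto simp: subspace_scale subspace_diff linear_diff[OF lin1] linear_scale[OF lin1])
    then show "x' = x /\<^sub>R t" by simp
  qed
qed

text \<open>Trial and test functions of the optimality system are pairs. Copies of \<open>D\<close>
  on the two coordinate axes give the finite spanning set that the solvability lemma asks
  for.\<close>

lemma span_Times_finite:
  fixes D :: "'a::real_vector set"
  assumes "finite D"
  shows "\<exists>E. finite E \<and> span E = span D \<times> span D"
proof (intro exI conjI)
  let ?E = "(\<lambda>x. (x, 0)) ` D \<union> (\<lambda>x. (0, x)) ` D"
  show "finite ?E" using assms by simp
  have lin: "linear (\<lambda>x::'a. (x, 0::'a))" "linear (\<lambda>x::'a. (0::'a, x))"
    by (auto intro!: linearI)
  show "span ?E = span D \<times> span D"
    unfolding span_Un linear_span_image[OF lin(1)] linear_span_image[OF lin(2)]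
    by (auto simp: image_iff)
qed

section \<open>Piecewise affine functions and the dimension of the finite element space\<close>

lemma cont_piecewise_affine_add:
  assumes "v \<in> cont_piecewise_affine \<Omega> \<T>" "w \<in> cont_piecewise_affine \<Omega> \<T>"
  shows "(\<lambda>x. v x + w x) \<in> cont_piecewise_affine \<Omega> \<T>"
  unfolding cont_piecewise_affine_def
proof (intro CollectI conjI ballI)
  show "continuous_on (closure \<Omega>) (\<lambda>x. v x + w x)"
    using assms by (auto simp: cont_piecewise_affine_def intro: continuous_on_add)
next
  fix T assume "T \<in> \<T>"
  then obtain b k b' k' where "\<forall>x\<in>T. v x = b \<bullet> x + k" "\<forall>x\<in>T. w x = b' \<bullet> x + k'"
    using assms unfolding cont_piecewise_affine_def by blast
  then have "\<forall>x\<in>T. v x + w x = (b + b') \<bullet> x + (k + k')"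
    by (simp add: inner_add_left)
  then show "\<exists>b k. \<forall>x\<in>T. v x + w x = b \<bullet> x + k" by blast
qed

lemma cont_piecewise_affine_scale:
  assumes "v \<in> cont_piecewise_affine \<Omega> \<T>"
  shows "(\<lambda>x. r * v x) \<in> cont_piecewise_affine \<Omega> \<T>"
  unfolding cont_piecewise_affine_def
proof (intro CollectI conjI ballI)
  show "continuous_on (closure \<Omega>) (\<lambda>x. r * v x)"
    using assms by (auto simp: cont_piecewise_affine_def intro: continuous_on_mult_left)
next
  fix T assume "T \<in> \<T>"
  then obtain b k where "\<forall>x\<in>T. v x = b \<bullet> x + k"
    using assms unfolding cont_piecewise_affine_def by blast
  then have "\<forall>x\<in>T. r * v x = (r *\<^sub>R b) \<bullet> x + r * k"
    by (simp add: distrib_left)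
  then show "\<exists>b k. \<forall>x\<in>T. r * v x = b \<bullet> x + k" by blast
qed

lemma cont_piecewise_affine_zero: "(\<lambda>x. 0) \<in> cont_piecewise_affine \<Omega> \<T>"
  unfolding cont_piecewise_affine_def by (auto intro!: exI[of _ 0])

lemma cont_piecewise_affine_sum:
  assumes "\<And>i. i \<in> I \<Longrightarrow> v i \<in> cont_piecewise_affine \<Omega> \<T>"
  shows "(\<lambda>x. \<Sum>i\<in>I. k i * v i x) \<in> cont_piecewise_affine \<Omega> \<T>"
  using assms
proof (induction I rule: infinite_finite_induct)
  case (insert i I)
  then show ?case
    using cont_piecewise_affine_add[OF cont_piecewise_affine_scale[of "v i" \<Omega> \<T> "k i"]] by simp
qed (simp_all add: cont_piecewise_affine_zero)

lemma function_space_zero: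
  assumes "function_space M f"
  shows "AE x in M. f 0 x = 0"
proof -
  have "AE x in M. f ((0::real) *\<^sub>R 0) x = 0 * f 0 x"
    using assms unfolding function_space_def by blast
  then show ?thesis by simp
qed

text \<open>Representatives are linear only modulo null sets. A finite sum collects finitely many
  exceptional null sets, so the identity still holds almost everywhere.\<close>

lemma function_space_sum:
  assumes f: "function_space M f" and "\<And>i. i \<in> I \<Longrightarrow> AE x in M. f (e i) x = v i x"
  shows "AE x in M. f (\<Sum>i\<in>I. k i *\<^sub>R e i) x = (\<Sum>i\<in>I. k i * v i x)"
  using assms(2)
proof (induction I rule: infinite_finite_induct)
  case (insert i I)
  have "AE x in M. f (k i *\<^sub>R e i + (\<Sum>i\<in>I. k i *\<^sub>R e i)) x
          = f (k i *\<^sub>R e i) x + f (\<Sum>i\<in>I. k i *\<^sub>R e i) x"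
    and "AE x in M. f (k i *\<^sub>R e i) x = k i * f (e i) x"
    using f unfolding function_space_def by blast+
  moreover have "AE x in M. f (e i) x = v i x"
    and "AE x in M. f (\<Sum>i\<in>I. k i *\<^sub>R e i) x = (\<Sum>i\<in>I. k i * v i x)"
    using insert by auto
  ultimately show ?case
    by eventually_elim (use insert.hyps in simp)
\<comment> \<open>For an empty or an infinite index set both sums are 0 by convention, and what
  remains is that \<open>f 0\<close> vanishes almost everywhere.\<close>
qed (use function_space_zero[OF f] in auto)

text \<open>On each cell the function is affine, so its zero set there is cut out by a convex set;
  containing the vertices \<open>C T\<close>, that set contains their hull \<open>T\<close>. The
  cells cover \<open>closure \<Omega>\<close>.\<close>

lemma cont_piecewise_affine_eq_0_on_vertices:
  assumes v: "v \<in> cont_piecewise_affine \<Omega> \<T>" and mesh: "triangulation_of \<Omega> \<T>"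
    and C: "\<And>T. T \<in> \<T> \<Longrightarrow> T = convex hull (C T)"
    and zero: "\<And>w. w \<in> (\<Union>T\<in>\<T>. C T) \<Longrightarrow> v w = 0"
    and x: "x \<in> closure \<Omega>"
  shows "v x = 0"
proof -
  obtain T where T: "T \<in> \<T>" "x \<in> T"
    using x mesh unfolding triangulation_of_def by blast
  obtain b k where bk: "\<And>x. x \<in> T \<Longrightarrow> v x = b \<bullet> x + k"
    using v T(1) unfolding cont_piecewise_affine_def by blast
  have "C T \<subseteq> T" using C[OF T(1)] hull_subset by metis
  \<comment> \<open>For \<open>b = 0\<close> this set is empty or the whole space, which is still
    convex, so constant pieces need no separate case.\<close>
  then have "C T \<subseteq> {x. b \<bullet> x = - k}"
    using bk zero T(1) by (fastforce simp: eq_neg_iff_add_eq_0)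
  then have "T \<subseteq> {x. b \<bullet> x = - k}"
    using hull_minimal[of "C T" "{x. b \<bullet> x = - k}" convex, OF _ convex_hyperplane]
    by (simp flip: C[OF T(1)])
  with bk T(2) show ?thesis by (auto simp: eq_neg_iff_add_eq_0)
qed

lemma subspace_fe_space:
  assumes "function_space (lebesgue_on \<Omega>) f"
  shows "subspace (fe_space \<Omega> \<T> f)"
proof (rule subspaceI)
  show "0 \<in> fe_space \<Omega> \<T> f"
    using function_space_zero[OF assms] unfolding fe_space_def
    by (intro CollectI bexI[OF _ cont_piecewise_affine_zero])
next
  fix y z assume "y \<in> fe_space \<Omega> \<T> f" "z \<in> fe_space \<Omega> \<T> f"
  then obtain v w where vw: "v \<in> cont_piecewise_affine \<Omega> \<T>" "w \<in> cont_piecewise_affine \<Omega> \<T>"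
    "AE x in lebesgue_on \<Omega>. f y x = v x" "AE x in lebesgue_on \<Omega>. f z x = w x"
    unfolding fe_space_def by blast
  have "AE x in lebesgue_on \<Omega>. f (y + z) x = f y x + f z x"
    using assms unfolding function_space_def by blast
  with vw(3,4) have "AE x in lebesgue_on \<Omega>. f (y + z) x = v x + w x"
    by eventually_elim simp
  then show "y + z \<in> fe_space \<Omega> \<T> f"
    unfolding fe_space_def by (intro CollectI bexI[OF _ cont_piecewise_affine_add[OF vw(1,2)]])
next
  fix r y assume "y \<in> fe_space \<Omega> \<T> f"
  then obtain v where v: "v \<in> cont_piecewise_affine \<Omega> \<T>" "AE x in lebesgue_on \<Omega>. f y x = v x"
    unfolding fe_space_def by blast
  have "AE x in lebesgue_on \<Omega>. f (r *\<^sub>R y) x = r * f y x"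
    using assms unfolding function_space_def by blast
  with v(2) have "AE x in lebesgue_on \<Omega>. f (r *\<^sub>R y) x = r * v x"
    by eventually_elim simp
  then show "r *\<^sub>R y \<in> fe_space \<Omega> \<T> f"
    unfolding fe_space_def by (intro CollectI bexI[OF _ cont_piecewise_affine_scale[OF v(1)]])
qed

text \<open>Among more elements than mesh vertices, some nontrivial combination vanishes at all
  vertices, hence on the whole closure, hence is the zero element. An independent set is therefore
  no larger than the vertex set.\<close>

lemma fe_space_finite_dim:
  assumes f: "function_space (lebesgue_on \<Omega>) f" and mesh: "triangulation_of \<Omega> \<T>"
  shows "\<exists>B. finite B \<and> span B = fe_space \<Omega> \<T> f"
proof -
  have "\<forall>T\<in>\<T>. \<exists>C. finite C \<and> T = convex hull C"
    using mesh unfolding triangulation_of_def simplex_def by (metis aff_independent_finite)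
  then obtain C where C: "\<And>T. T \<in> \<T> \<Longrightarrow> finite (C T)" "\<And>T. T \<in> \<T> \<Longrightarrow> T = convex hull (C T)"
    by metis
  define W where "W = (\<Union>T\<in>\<T>. C T)"
  have finW: "finite W"
    using C(1) mesh unfolding W_def triangulation_of_def triangulation_def by blast
  obtain B where B: "B \<subseteq> fe_space \<Omega> \<T> f" "independent B" "fe_space \<Omega> \<T> f \<subseteq> span B"
    using maximal_independent_subset by blast
  \<comment> \<open>\<open>B\<close> is not yet known to be finite, so the bound is proved for its
    finite subsets.\<close>
  have "card A \<le> card W" if A: "A \<subseteq> B" "finite A" for A
  proof (rule ccontr)
    assume "\<not> card A \<le> card W"
    have "\<forall>e\<in>A. \<exists>v. v \<in> cont_piecewise_affine \<Omega> \<T> \<and> (AE x in lebesgue_on \<Omega>. f e x = v x)"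
      using A(1) B(1) unfolding fe_space_def by blast
    \<comment> \<open>Vertex values are read off the continuous representative \<open>v e\<close>;
      \<open>f e\<close> agrees with it only almost everywhere, so its own values at single points
      carry no information.\<close>
    then obtain v where v: "\<And>e. e \<in> A \<Longrightarrow> v e \<in> cont_piecewise_affine \<Omega> \<T>"
        "\<And>e. e \<in> A \<Longrightarrow> AE x in lebesgue_on \<Omega>. f e x = v e x"
      by metis
    obtain k where k: "\<exists>e\<in>A. k e \<noteq> 0" "\<forall>w\<in>W. (\<Sum>e\<in>A. k e * v e w) = 0"
      using homogeneous_system_nontrivial[OF finW A(2), of v] \<open>\<not> card A \<le> card W\<close> by auto
    have zero: "(\<Sum>e\<in>A. k e * v e x) = 0" if "x \<in> closure \<Omega>" for x
      using cont_piecewise_affine_eq_0_on_vertices[OF cont_piecewise_affine_sum mesh C(2) _ that]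
        v(1) k(2) unfolding W_def by blast
    have "AE x in lebesgue_on \<Omega>. f (\<Sum>e\<in>A. k e *\<^sub>R e) x = (\<Sum>e\<in>A. k e * v e x)"
      using v(2) by (rule function_space_sum[OF f])
    then have "AE x in lebesgue_on \<Omega>. f (\<Sum>e\<in>A. k e *\<^sub>R e) x = 0"
      using AE_space[of "lebesgue_on \<Omega>"]
    proof eventually_elim
      case (elim x)
      then have "x \<in> \<Omega>" by simp
      then show ?case using elim zero closure_subset by auto
    qed
    then have "(\<Sum>e\<in>A. k e *\<^sub>R e) = 0"
      using f unfolding function_space_def by blast
    with k(1) independentD[OF B(2) A(2,1)] show False by blast
  qed
  then have "finite B"
    \<comment> \<open>An infinite \<open>B\<close> would contain a finite subset with
      \<open>Suc (card W)\<close> elements.\<close>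
    by (metis infinite_arbitrarily_large not_less_eq_eq order_refl)
  moreover have "span B = fe_space \<Omega> \<T> f"
    using B subspace_fe_space[OF f] by (metis span_minimal subset_antisym)
  ultimately show ?thesis by blast
qed

section \<open>Unique solvability of the optimality system\<close>

text \<open>The degenerate case of Cauchy-Schwarz. Since \<open>m y y = 0\<close>, the value of the
  quadratic form at \<open>q + t *\<^sub>R y\<close> is affine in \<open>t\<close>, and a nonzero
  slope would make it negative somewhere; the \<open>t\<close> chosen below makes it -1.\<close>

lemma psd_bilinear_null:
  fixes m :: "'a::real_vector \<Rightarrow> 'a \<Rightarrow> real"
  assumes "bilinear m" and sym: "\<And>x y. m x y = m y x" and psd: "\<And>x. m x x \<ge> 0"
    and "m y y = 0"
  shows "m y q = 0"
proof (rule ccontr)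
  assume *: "m y q \<noteq> 0"
  define t where "t = - (m q q + 1) / (2 * m y q)"
  have "m (q + t *\<^sub>R y) (q + t *\<^sub>R y) = m q q + 2 * t * m y q"
    using assms(1,4) by (simp add: bilinear_ladd bilinear_radd bilinear_lmul bilinear_rmul sym[of q y])
  also have "\<dots> = - 1" using * by (simp add: t_def field_simps)
  finally show False using psd[of "q + t *\<^sub>R y"] by simp
qed

text \<open>The spaces are abstract Hilbert spaces with representative maps, so the inclusions of Y
  into the observation and control spaces become the linear maps \<open>j_obs\<close> and
  \<open>j_u\<close>. The measure \<open>\<sigma>\<close> covers both control on a region (Lebesgue)
  and control on a hypersurface such as a part of the boundary (Hausdorff). \<open>m_obs\<close> is
  \<open>m\<close> with its first argument in the observation space, as the datum \<open>yd\<close>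
  requires.\<close>

theorem theorem4:
  fixes P :: "(real ^ 'd) set"
    and \<Omega> \<Omega>_obs \<Omega>_u :: "(real ^ 'n) set"
    and \<T> :: "(real ^ 'n) set set"
    and \<sigma> :: "(real ^ 'n) measure"
    and fY :: "'y::{real_inner,banach} \<Rightarrow> real ^ 'n \<Rightarrow> real"
    and fU :: "'u::{real_inner,banach} \<Rightarrow> real ^ 'n \<Rightarrow> real"
    and fO :: "'o::{real_inner,banach} \<Rightarrow> real ^ 'n \<Rightarrow> real"
    and j_obs :: "'y \<Rightarrow> 'o" and j_u :: "'y \<Rightarrow> 'u"
    and c_obs c_u c_a \<gamma>_a c_c c_m :: "real ^ 'd \<Rightarrow> real"
    and a :: "real ^ 'd \<Rightarrow> 'y \<Rightarrow> 'y \<Rightarrow> real"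
    and c :: "real ^ 'd \<Rightarrow> 'u \<Rightarrow> 'y \<Rightarrow> real"
    and m :: "real ^ 'd \<Rightarrow> 'y \<Rightarrow> 'y \<Rightarrow> real"
    and m_obs :: "real ^ 'd \<Rightarrow> 'o \<Rightarrow> 'y \<Rightarrow> real"
    and G :: "real ^ 'd \<Rightarrow> 'y \<Rightarrow>\<^sub>L real"
    and Q_C :: nat and c_C :: "nat \<Rightarrow> real ^ 'd \<Rightarrow> real" and \<Omega>_C :: "nat \<Rightarrow> (real ^ 'n) set"
    and w_obs :: "real ^ 'd \<Rightarrow> real ^ 'n \<Rightarrow> real"
    and Y_obs_h :: "'o set"
    and N_h :: nat
    and \<alpha> :: real
  assumes n: "CARD('n) \<in> {1, 2, 3}"
    and \<alpha>: "0 < \<alpha>" "\<alpha> \<le> 1"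
    and \<Omega>: "lipschitz_domain \<Omega>" "bounded \<Omega>"
    and \<Omega>_obs: "\<Omega>_obs \<subseteq> \<Omega>" "\<Omega>_obs \<in> sets lebesgue"
    and \<Omega>_u: "\<Omega>_u \<subseteq> closure \<Omega>" "\<Omega>_u \<in> sets borel"
    and \<sigma>: "\<sigma> = lebesgue_on \<Omega>_u \<or>
            \<sigma> = restrict_space (hausdorff_measure (CARD('n) - 1)) \<Omega>_u"
    and Y_separable: "separable_space (euclidean :: 'y topology)"
    and Y_L2: "L2_function_space (lebesgue_on \<Omega>) fY"
    and U_L2: "L2_function_space \<sigma> fU"
    and Y_obs: "function_space (lebesgue_on \<Omega>_obs) fO"
    and Y_sub_obs: "restriction_map \<Omega> \<Omega>_obs (lebesgue_on \<Omega>_obs) fY fO j_obs"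
    and Y_sub_U: "restriction_map \<Omega> \<Omega>_u \<sigma> fY fU j_u"
    and c_obs: "\<And>\<mu>. \<mu> \<in> P \<Longrightarrow> c_obs \<mu> > 0 \<and> (\<forall>y. norm (j_obs y) \<le> c_obs \<mu> * norm y)"
    and c_u: "\<And>\<mu>. \<mu> \<in> P \<Longrightarrow> c_u \<mu> > 0 \<and> (\<forall>y. norm (j_u y) \<le> c_u \<mu> * norm y)"
    and a_cont: "\<And>\<mu>. \<mu> \<in> P \<Longrightarrow> continuous_bilinear (a \<mu>) (c_a \<mu>)"
    and a_coercive: "\<And>\<mu>. \<mu> \<in> P \<Longrightarrow> coercive (a \<mu>) (\<gamma>_a \<mu>)"
    and c_cont: "\<And>\<mu>. \<mu> \<in> P \<Longrightarrow> continuous_bilinear (c \<mu>) (c_c \<mu>)"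
    and c_C_pos: "\<And>\<mu> i. \<mu> \<in> P \<Longrightarrow> i \<in> {1..Q_C} \<Longrightarrow> c_C i \<mu> > 0"
    and \<Omega>_C: "\<And>i. i \<in> {1..Q_C} \<Longrightarrow> \<Omega>_C i \<in> sets borel" "(\<Union>i\<in>{1..Q_C}. \<Omega>_C i) = \<Omega>_u"
    and c_L2: "\<And>\<mu> u z. \<mu> \<in> P \<Longrightarrow>
      has_bochner_integral \<sigma>
        (\<lambda>x. (\<Sum>i=1..Q_C. c_C i \<mu> * indicat_real (\<Omega>_C i) x) * fU u x * fU (j_u z) x)
        (c \<mu> u z)"
    and m_cont: "\<And>\<mu>. \<mu> \<in> P \<Longrightarrow> continuous_bilinear (m \<mu>) (c_m \<mu>)"
    and m_sym: "\<And>\<mu> y z. \<mu> \<in> P \<Longrightarrow> m \<mu> y z = m \<mu> z y"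
    and m_psd: "\<And>\<mu> y. \<mu> \<in> P \<Longrightarrow> m \<mu> y y \<ge> 0"
    and w_obs: "\<And>\<mu>. \<mu> \<in> P \<Longrightarrow> w_obs \<mu> \<in> borel_measurable (lebesgue_on \<Omega>_obs) \<and>
                              (\<forall>x\<in>\<Omega>_obs. w_obs \<mu> x > 0)"
    and m_L2: "\<And>\<mu> y z. \<mu> \<in> P \<Longrightarrow>
      has_bochner_integral (lebesgue_on \<Omega>_obs) (\<lambda>x. w_obs \<mu> x * fY y x * fY z x) (m \<mu> y z)"
    and m_obs_cont: "\<And>\<mu>. \<mu> \<in> P \<Longrightarrow> \<exists>C. continuous_bilinear (m_obs \<mu>) C"
    and m_obs_L2: "\<And>\<mu> g z. \<mu> \<in> P \<Longrightarrow>
      has_bochner_integral (lebesgue_on \<Omega>_obs) (\<lambda>x. w_obs \<mu> x * fO g x * fY z x) (m_obs \<mu> g z)"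
    and c_eq_m: "\<And>\<mu> y z. \<mu> \<in> P \<Longrightarrow> \<Omega>_u = \<Omega>_obs \<Longrightarrow> c \<mu> (j_u y) z = m \<mu> y z"
    and mesh: "triangulation_of \<Omega> \<T>"
    and N_h: "dim (fe_space \<Omega> \<T> fY) = N_h"
    and Y_obs_h: "subspace Y_obs_h" "\<exists>B. finite B \<and> span B = Y_obs_h"
  shows "\<forall>\<mu>\<in>P. \<forall>yd\<in>Y_obs_h.
    \<exists>!yp. yp \<in> fe_space \<Omega> \<T> fY \<times> fe_space \<Omega> \<T> fY \<and>
      (\<forall>zq \<in> fe_space \<Omega> \<T> fY \<times> fe_space \<Omega> \<T> fY.
         B_s (a \<mu>) (c \<mu>) (m \<mu>) j_u \<alpha> yp zq = F_s (m_obs \<mu>) (G \<mu>) yd zq)"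
proof (intro ballI)
  fix \<mu> yd assume \<mu>: "\<mu> \<in> P" and "yd \<in> Y_obs_h"
  let ?H = "fe_space \<Omega> \<T> fY"
  have fY: "function_space (lebesgue_on \<Omega>) fY"
    using Y_L2 by (simp add: L2_function_space_def)
  have sub: "subspace ?H" by (rule subspace_fe_space[OF fY])
  obtain D where D: "finite D" "span D = ?H \<times> ?H"
    using fe_space_finite_dim[OF fY mesh] span_Times_finite by metis
  have bil: "bilinear (a \<mu>)" "bilinear (c \<mu>)" "bilinear (m \<mu>)" "bilinear (m_obs \<mu>)"
    using a_cont[OF \<mu>] c_cont[OF \<mu>] m_cont[OF \<mu>] m_obs_cont[OF \<mu>]
    by (auto simp: continuous_bilinear_def)
  have j: "linear j_u" using Y_sub_U by (simp add: restriction_map_def)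
  have a0: "y = 0" if "a \<mu> y y = 0" for y
  proof -
    have "\<gamma>_a \<mu> > 0" "\<gamma>_a \<mu> * (norm y)\<^sup>2 \<le> 0"
      using a_coercive[OF \<mu>] that by (auto simp: coercive_def) (metis that)
    then show ?thesis by (simp add: mult_le_0_iff)
  qed
  have c_nonneg: "c \<mu> (j_u p) p \<ge> 0" for p
  proof -
    have "c \<mu> (j_u p) p = (\<integral>x. (\<Sum>i=1..Q_C. c_C i \<mu> * indicat_real (\<Omega>_C i) x)
            * fU (j_u p) x * fU (j_u p) x \<partial>\<sigma>)"
      using c_L2[OF \<mu>, of "j_u p" p] by (simp add: has_bochner_integral_iff)
    also have "\<dots> \<ge> 0"
      \<comment> \<open>Both arguments enter the integral through \<open>j_u\<close>. Regrouping
        displays the integrand as a nonnegative weight times the square of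
        \<open>fU (j_u p) x\<close>.\<close>
      unfolding mult.assoc
      by (intro integral_nonneg_AE AE_I2 mult_nonneg_nonneg sum_nonneg zero_le_square)
        (simp_all add: c_C_pos[OF \<mu>] less_imp_le)
    finally show ?thesis .
  qed
  let ?B = "B_s (a \<mu>) (c \<mu>) (m \<mu>) j_u \<alpha>"
  note lin = bil[THEN bilinear_ladd] bil[THEN bilinear_radd] bil[THEN bilinear_lmul]
    bil[THEN bilinear_rmul] linear_add[OF j] linear_scale[OF j]
  note zero = bil[THEN bilinear_lzero] bil[THEN bilinear_rzero] linear_0[OF j]
  have "bilinear ?B"
    unfolding bilinear_def
    by (intro conjI allI linearI) (auto simp: B_s_def lin algebra_simps add_divide_distrib)
  moreover have "linear (F_s (m_obs \<mu>) (G \<mu>) yd)"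
    by (intro linearI)
      (auto simp: F_s_def lin blinfun.add_right blinfun.scaleR_right algebra_simps)
  moreover have "yp = 0"
    if yp: "yp \<in> ?H \<times> ?H" and null: "\<And>zq. zq \<in> ?H \<times> ?H \<Longrightarrow> ?B yp zq = 0" for yp
  proof -
    obtain y p where [simp]: "yp = (y, p)" and H: "y \<in> ?H" "p \<in> ?H" using yp by auto
    have H0: "0 \<in> ?H" using sub by (rule subspace_0)
    \<comment> \<open>Test pairs with one zero component decouple the system: \<open>(z, 0)\<close>
      gives the state equation, \<open>(0, q)\<close> the adjoint equation.\<close>
    have eq1: "a \<mu> y z = c \<mu> (j_u p) z / \<alpha>" if "z \<in> ?H" for z
      using null[of "(z, 0)"] that H0 by (simp add: B_s_def zero)
    have eq2: "a \<mu> q p = - m \<mu> y q" if "q \<in> ?H" for q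
      using null[of "(0, q)"] that H0 by (simp add: B_s_def zero)
    have "c \<mu> (j_u p) p / \<alpha> = - m \<mu> y y"
      using eq1[OF H(2)] eq2[OF H(1)] by simp
    moreover have "c \<mu> (j_u p) p / \<alpha> \<ge> 0" using c_nonneg \<alpha>(1) by simp
    ultimately have "m \<mu> y y = 0" using m_psd[OF \<mu>, of y] by simp
    then have "m \<mu> y q = 0" for q
      by (rule psd_bilinear_null[OF bil(3) m_sym[OF \<mu>] m_psd[OF \<mu>]])
    \<comment> \<open>The adjoint equation at \<open>q = p\<close> now reads
      \<open>a \<mu> p p = 0\<close>. Once \<open>p = 0\<close>, the state equation at
      \<open>z = y\<close> reads \<open>a \<mu> y y = 0\<close>.\<close>
    then have p: "p = 0" using eq2 H(2) a0 by simp
    then have "y = 0" using eq1 H(1) a0 by (simp add: zero)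
    with p show ?thesis by (simp add: zero_prod_def)
  qed
  ultimately show "\<exists>!yp. yp \<in> ?H \<times> ?H \<and> (\<forall>zq \<in> ?H \<times> ?H.
      ?B yp zq = F_s (m_obs \<mu>) (G \<mu>) yd zq)"
    by (rule nondegenerate_bilinear_unique_solution[OF _ _ D])
qed

end
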